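(* If the no-arbitrage condition (NA) and the efficient friction assumption (EF) are both satisfied, then the set $\mathcal{K}-L^0_+(\Omega,\mathcal{F}_T,\mathbb{P};\mathbb{R})=\{Y-X: Y\in\mathcal{K},\ X\in L^0_+(\Omega,\mathcal{F}_T,\mathbb{P};\mathbb{R})\}$ is closed with respect to convergence in probability $\mathbb{P}$.
   Context: Fix integers $T\ge 1$, $N\ge 1$ and a filtered probability space $(\Omega,\mathcal{F}_T,\mathbb{F}=(\mathcal{F}_t)_{t=0}^T,\mathbb{P})$. All equalities and inequalities between random variables/processes are $\mathbb{P}$-a.s. and coordinate-wise. $\Delta X_t:=X_t-X_{t-1}$. Market: a savings account $B_t=\prod_{s=0}^t(1+r_s)$, with $r=(r_t)_{t=0}^T$ a nonnegative adapted process, $r_0=0$ (so $B_0=1$); adapted $\mathbb{R}^N$-valued ex-dividend price processes $P^{ask},P^{bid}$ (indexed by $t=0,\dots,T$) and adapted $\mathbb{R}^N$-valued cumulative dividend processes $A^{ask},A^{bid}$ (indexed by $t=1,\dots,T$, with the convention $A^{ask}_0=A^{bid}_0=0$). Standing Bid-Ask Assumption: $P^{ask}\ge P^{bid}$ and $\Delta A^{ask}\le\Delta A^{bid}$. A trading strategy is an $\mathbb{R}^{N+1}$-valued predictable process $\phi=(\phi^0_t,\phi^1_t,\dots,\phi^N_t)_{t=1}^T$ ($\phi_t$ is $\mathcal{F}_{t-1}$-measurable), with convention $\phi_0=0$. Its value process is $V_0(\phi)=\phi^0_1+\sum_{j=1}^N\phi^j_1(1_{\{\phi^j_1\ge0\}}P^{ask,j}_0+1_{\{\phi^j_1<0\}}P^{bid,j}_0)$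 and, for $1\le t\le T$, $V_t(\phi)=\phi^0_tB_t+\sum_{j=1}^N\phi^j_t(1_{\{\phi^j_t\ge0\}}P^{bid,j}_t+1_{\{\phi^j_t<0\}}P^{ask,j}_t)+\sum_{j=1}^N\phi^j_t(1_{\{\phi^j_t\ge0\}}\Delta A^{ask,j}_t+1_{\{\phi^j_t<0\}}\Delta A^{bid,j}_t)$. Set $V^*(\phi)=B^{-1}V(\phi)$. $\phi$ is self-financing if for $t=1,\dots,T-1$: $B_t\Delta\phi^0_{t+1}+\sum_{j=1}^N\Delta\phi^j_{t+1}(1_{\{\Delta\phi^j_{t+1}\ge0\}}P^{ask,j}_t+1_{\{\Delta\phi^j_{t+1}<0\}}P^{bid,j}_t)=\sum_{j=1}^N\phi^j_t(1_{\{\phi^j_t\ge0\}}\Delta A^{ask,j}_t+1_{\{\phi^j_t<0\}}\Delta A^{bid,j}_t)$. $\mathcal{S}$ is the set of self-financing trading strategies. $\mathcal{K}:=\{V^*_T(\phi):\phi\in\mathcal{S},\ V_0(\phi)=0\}$. $L^0_+(\Omega,\mathcal{F}_T,\mathbb{P};\mathbb{R})$ is the set of (classes of) nonnegative $\mathcal{F}_T$-measurable real random variables. (NA): for each $\phi\in\mathcal{S}$ with $V_0(\phi)=0$ and $V_T(\phi)\ge0$, one has $V_T(\phi)=0$. (EF): $\{\phi\in\mathcal{S}:V_0(\phi)=V_T(\phi)=0\}=\{0\}$. *)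

theory Defs
  imports "HOL-Probability.Probability"
begin

text \<open>
  Random variables are functions rather than classes modulo null sets, so every (in)equality
  between random variables or processes is stated with \<open>AE\<close>. The order on \<open>real ^ 'n\<close>
  is the coordinate-wise one.
\<close>

definition converges_in_prob ::
    "'a measure \<Rightarrow> (nat \<Rightarrow> 'a \<Rightarrow> real) \<Rightarrow> ('a \<Rightarrow> real) \<Rightarrow> bool" where
  "converges_in_prob M X Y \<longleftrightarrow>
     (\<forall>\<epsilon>>0. (\<lambda>n. measure M {\<omega> \<in> space M. \<epsilon> < \<bar>X n \<omega> - Y \<omega>\<bar>}) \<longlonglongrightarrow> 0)"

text \<open>Convergence in probability is metrizable, so closedness is sequential closedness.\<close>

definition closed_in_prob :: "'a measure \<Rightarrow> ('a \<Rightarrow> real) set \<Rightarrow> bool" where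
  "closed_in_prob M C \<longleftrightarrow>
     (\<forall>X Y. (\<forall>n. X n \<in> C) \<and> Y \<in> borel_measurable M \<and> converges_in_prob M X Y \<longrightarrow> Y \<in> C)"

text \<open>
  \<open>two_sided x p q\<close> is
  \<open>\<Sum>\<^sub>j x\<^sup>j (1 {x\<^sup>j \<ge> 0} p\<^sup>j + 1 {x\<^sup>j < 0} q\<^sup>j)\<close>: long positions (or purchases) are weighted
  with \<open>p\<close>, short positions (or sales) with \<open>q\<close>.
\<close>

definition two_sided :: "real ^ 'n \<Rightarrow> real ^ 'n \<Rightarrow> real ^ 'n \<Rightarrow> real" where
  "two_sided x p q = (\<Sum>j\<in>UNIV. x $ j * (if 0 \<le> x $ j then p $ j else q $ j))"

text \<open>
  The horizon is \<open>T\<close> and \<open>N = CARD('n)\<close>. Only the members of the filtration with index at most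
  \<open>T\<close> are relevant (a finite filtration can be continued constantly after \<open>T\<close>), and likewise
  for all processes; \<open>M\<close> carries the probability measure on the sigma-algebra of \<open>F T\<close>.
\<close>

locale bid_ask_market = prob_space M + filtration "space M" F
  for M :: "'a measure" and F :: "nat \<Rightarrow> 'a measure" +
  fixes T :: nat
    and r :: "nat \<Rightarrow> 'a \<Rightarrow> real"
    and P_ask P_bid A_ask A_bid :: "nat \<Rightarrow> 'a \<Rightarrow> real ^ 'n"
  assumes T_ge_1: "1 \<le> T"
    and sets_F_T: "sets (F T) = sets M"
    and r_adapted: "\<And>t. t \<le> T \<Longrightarrow> r t \<in> borel_measurable (F t)"
    and r_nonneg: "\<And>t. t \<le> T \<Longrightarrow> AE \<omega> in M. 0 \<le> r t \<omega>"
    and r_0: "AE \<omega> in M. r 0 \<omega> = 0"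
    and P_ask_adapted: "\<And>t. t \<le> T \<Longrightarrow> P_ask t \<in> borel_measurable (F t)"
    and P_bid_adapted: "\<And>t. t \<le> T \<Longrightarrow> P_bid t \<in> borel_measurable (F t)"
    and A_ask_adapted: "\<And>t. 1 \<le> t \<Longrightarrow> t \<le> T \<Longrightarrow> A_ask t \<in> borel_measurable (F t)"
    and A_bid_adapted: "\<And>t. 1 \<le> t \<Longrightarrow> t \<le> T \<Longrightarrow> A_bid t \<in> borel_measurable (F t)"
    and A_ask_0: "A_ask 0 = (\<lambda>\<omega>. 0)"
    and A_bid_0: "A_bid 0 = (\<lambda>\<omega>. 0)"
    and P_bid_le_ask: "\<And>t. t \<le> T \<Longrightarrow> AE \<omega> in M. P_bid t \<omega> \<le> P_ask t \<omega>"
    and A_ask_le_bid: "\<And>t. 1 \<le> t \<Longrightarrow> t \<le> T \<Longrightarrow>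
          AE \<omega> in M. A_ask t \<omega> - A_ask (t - 1) \<omega> \<le> A_bid t \<omega> - A_bid (t - 1) \<omega>"
begin

definition B :: "nat \<Rightarrow> 'a \<Rightarrow> real" where
  "B t \<omega> = (\<Prod>s=0..t. 1 + r s \<omega>)"

definition dividends :: "(nat \<Rightarrow> 'a \<Rightarrow> real \<times> (real ^ 'n)) \<Rightarrow> nat \<Rightarrow> 'a \<Rightarrow> real" where
  "dividends \<phi> t \<omega> =
     two_sided (snd (\<phi> t \<omega>)) (A_ask t \<omega> - A_ask (t - 1) \<omega>) (A_bid t \<omega> - A_bid (t - 1) \<omega>)"

text \<open>A strategy pairs the savings account position with the \<open>N\<close> positions in the securities.\<close>

definition trading_strategy :: "(nat \<Rightarrow> 'a \<Rightarrow> real \<times> (real ^ 'n)) \<Rightarrow> bool" where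
  "trading_strategy \<phi> \<longleftrightarrow>
     \<phi> 0 = (\<lambda>\<omega>. 0) \<and> (\<forall>t\<in>{1..T}. \<phi> t \<in> borel_measurable (F (t - 1)))"

definition V :: "(nat \<Rightarrow> 'a \<Rightarrow> real \<times> (real ^ 'n)) \<Rightarrow> nat \<Rightarrow> 'a \<Rightarrow> real" where
  "V \<phi> t \<omega> =
     (if t = 0 then fst (\<phi> 1 \<omega>) + two_sided (snd (\<phi> 1 \<omega>)) (P_ask 0 \<omega>) (P_bid 0 \<omega>)
      else fst (\<phi> t \<omega>) * B t \<omega> + two_sided (snd (\<phi> t \<omega>)) (P_bid t \<omega>) (P_ask t \<omega>)
           + dividends \<phi> t \<omega>)"

definition V_disc :: "(nat \<Rightarrow> 'a \<Rightarrow> real \<times> (real ^ 'n)) \<Rightarrow> nat \<Rightarrow> 'a \<Rightarrow> real" where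
  "V_disc \<phi> t \<omega> = V \<phi> t \<omega> / B t \<omega>"

definition self_financing :: "(nat \<Rightarrow> 'a \<Rightarrow> real \<times> (real ^ 'n)) \<Rightarrow> bool" where
  "self_financing \<phi> \<longleftrightarrow>
     (\<forall>t\<in>{1..T - 1}. AE \<omega> in M.
        B t \<omega> * (fst (\<phi> (t + 1) \<omega>) - fst (\<phi> t \<omega>))
        + two_sided (snd (\<phi> (t + 1) \<omega>) - snd (\<phi> t \<omega>)) (P_ask t \<omega>) (P_bid t \<omega>)
        = dividends \<phi> t \<omega>)"

definition S :: "(nat \<Rightarrow> 'a \<Rightarrow> real \<times> (real ^ 'n)) set" where
  "S = {\<phi>. trading_strategy \<phi> \<and> self_financing \<phi>}"

definition K :: "('a \<Rightarrow> real) set" where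
  "K = {V_disc \<phi> T | \<phi>. \<phi> \<in> S \<and> (AE \<omega> in M. V \<phi> 0 \<omega> = 0)}"

definition L0_plus :: "('a \<Rightarrow> real) set" where
  "L0_plus = {X \<in> borel_measurable (F T). AE \<omega> in M. 0 \<le> X \<omega>}"

text \<open>
  Since \<open>L0_plus\<close> contains every measurable modification of each of its members, so does this
  set, although \<open>K\<close> itself consists of individual representatives.
\<close>

definition K_minus_L0_plus :: "('a \<Rightarrow> real) set" where
  "K_minus_L0_plus = {(\<lambda>\<omega>. Y \<omega> - X \<omega>) | Y X. Y \<in> K \<and> X \<in> L0_plus}"

definition NA :: bool where
  "NA \<longleftrightarrow>
     (\<forall>\<phi>\<in>S. (AE \<omega> in M. V \<phi> 0 \<omega> = 0) \<and> (AE \<omega> in M. 0 \<le> V \<phi> T \<omega>)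
        \<longrightarrow> (AE \<omega> in M. V \<phi> T \<omega> = 0))"

text \<open>The right-hand side is the class of the zero strategy.\<close>

definition EF :: bool where
  "EF \<longleftrightarrow>
     {\<phi> \<in> S. (AE \<omega> in M. V \<phi> 0 \<omega> = 0) \<and> (AE \<omega> in M. V \<phi> T \<omega> = 0)}
     = {\<phi> \<in> S. \<forall>t\<in>{1..T}. AE \<omega> in M. \<phi> t \<omega> = 0}"

end

end

theory Submission
  imports Defs
begin

text \<open>
  A self-financing strategy of zero initial cost is determined by its positions in the risky
  securities, and its discounted terminal value is a continuous and positively homogeneous
  function of their path. By (NA) and (EF), positions with a nonnegative terminal value vanish.
  Given positions whose terminal values dominate an almost surely convergent sequence, one
  extracts limits date by date: at each date, a random subsequence, measurable with respect to
  the information then available, makes the positions converge wherever they are bounded. Where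
  they are unbounded, dividing by their norm makes the past vanish and would produce, by
  the same extraction at the later dates, nonzero positions with a nonnegative terminal value.
\<close>

subsection \<open>Measurable random subsequences\<close>

lemma measurable_random_index:
  fixes f :: "nat \<Rightarrow> 'a \<Rightarrow> 'b::topological_space"
  assumes "\<And>m. f m \<in> borel_measurable N" "\<tau> \<in> measurable N (count_space UNIV)"
  shows "(\<lambda>\<omega>. f (\<tau> \<omega>) \<omega>) \<in> borel_measurable N"
  by (rule measurable_compose_countable[OF assms])

text \<open>The bound \<open>m \<le> \<tau> m\<close> stands in for strict monotonicity: it forces
  the indices to infinity and survives composition, so extractions can be iterated.\<close>

lemma tendsto_random_index:
  fixes \<tau> :: "nat \<Rightarrow> nat"
  assumes "x \<longlonglongrightarrow> l" "\<And>m. m \<le> \<tau> m"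
  shows "(\<lambda>m. x (\<tau> m)) \<longlonglongrightarrow> l"
proof -
  have "filterlim \<tau> at_top at_top"
    using assms(2) by (intro filterlim_at_top_mono[OF filterlim_ident]) auto
  then show ?thesis
    using assms(1) filterlim_compose by blast
qed

text \<open>The limsup is a measurable choice of cluster point, finite where the sequence is
  bounded; \<open>\<tau> m\<close> is the first index from \<open>m\<close> on whose value lies
  within \<open>1 / (m + 1)\<close> of it.\<close>

lemma measurable_subsequence_real:
  fixes f :: "nat \<Rightarrow> 'a \<Rightarrow> real"
  assumes f [measurable]: "\<And>m. f m \<in> borel_measurable N"
  obtains \<tau> :: "nat \<Rightarrow> 'a \<Rightarrow> nat" where
    "\<And>m. \<tau> m \<in> measurable N (count_space UNIV)"
    "\<And>m \<omega>. m \<le> \<tau> m \<omega>"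
    "\<And>\<omega>. bounded (range (\<lambda>m. f m \<omega>)) \<Longrightarrow> convergent (\<lambda>m. f (\<tau> m \<omega>) \<omega>)"
proof -
  \<comment> \<open>Where the limsup is infinite, \<open>L\<close> takes the default value 0;
    convergence is claimed only on bounded sequences, where this does not occur.\<close>
  define L where "L \<omega> = real_of_ereal (limsup (\<lambda>m. ereal (f m \<omega>)))" for \<omega>
  have [measurable]: "L \<in> borel_measurable N"
    unfolding L_def by measurable
  define P where "P m k \<omega> \<longleftrightarrow> m \<le> k \<and> \<bar>f k \<omega> - L \<omega>\<bar> < 1 / real (Suc m)" for m k \<omega>
  have [measurable]: "Measurable.pred N (P m k)" for m k
    unfolding P_def by measurable
  \<comment> \<open>The fallback value \<open>m\<close> keeps
    \<open>m \<le> \<tau> m \<omega>\<close> true at every point.\<close>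
  define \<tau> where "\<tau> m \<omega> = (if \<exists>k. P m k \<omega> then LEAST k. P m k \<omega> else m)" for m \<omega>
  have \<tau>_measurable: "\<tau> m \<in> measurable N (count_space UNIV)" for m
    unfolding \<tau>_def by measurable
  have P_\<tau>: "P m (\<tau> m \<omega>) \<omega>" if "\<exists>k. P m k \<omega>" for m \<omega>
    using that LeastI_ex[OF that] by (simp add: \<tau>_def)
  have \<tau>_ge: "m \<le> \<tau> m \<omega>" for m \<omega>
    using P_\<tau>[of m \<omega>] by (cases "\<exists>k. P m k \<omega>") (auto simp: P_def \<tau>_def)
  have "convergent (\<lambda>m. f (\<tau> m \<omega>) \<omega>)" if bdd: "bounded (range (\<lambda>m. f m \<omega>))" for \<omega>
  proof -
    obtain C where "\<And>m. \<bar>f m \<omega>\<bar> \<le> C"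
      using bdd unfolding bounded_iff by auto
    then have C: "f m \<omega> \<le> C" "- C \<le> f m \<omega>" for m
      using abs_le_iff[of "f m \<omega>" C] by (metis, metis minus_le_iff)
    \<comment> \<open>This subsequence depends on \<open>\<omega>\<close> with no measurability; it
      only serves to show that the search defining \<open>\<tau>\<close> succeeds.\<close>
    obtain \<rho> :: "nat \<Rightarrow> nat" where \<rho>: "strict_mono \<rho>"
      and lim: "((\<lambda>m. ereal (f m \<omega>)) \<circ> \<rho>) \<longlonglongrightarrow> limsup (\<lambda>m. ereal (f m \<omega>))"
      using limsup_subseq_lim by blast
    have "limsup (\<lambda>m. ereal (f m \<omega>)) \<le> ereal C"
      using C by (intro lim[THEN LIMSEQ_le_const2]) auto
    moreover have "ereal (- C) \<le> limsup (\<lambda>m. ereal (f m \<omega>))"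
      using C by (intro lim[THEN LIMSEQ_le_const]) auto
    ultimately have "\<bar>limsup (\<lambda>m. ereal (f m \<omega>))\<bar> \<noteq> \<infinity>"
      by auto
    then have "limsup (\<lambda>m. ereal (f m \<omega>)) = ereal (L \<omega>)"
      by (simp add: L_def ereal_real')
    with lim have conv: "(\<lambda>m. f (\<rho> m) \<omega>) \<longlonglongrightarrow> L \<omega>"
      by (simp add: comp_def)
    have close: "\<exists>k. P m k \<omega>" for m
    proof -
      obtain n0 where n0: "\<And>n. n \<ge> n0 \<Longrightarrow> \<bar>f (\<rho> n) \<omega> - L \<omega>\<bar> < 1 / real (Suc m)"
        using LIMSEQ_D[OF conv, of "1 / real (Suc m)"] by auto
      have "m \<le> \<rho> (max m n0)"
        using seq_suble[OF \<rho>, of "max m n0"] by linarith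
      then show ?thesis
        using n0[of "max m n0"] unfolding P_def by auto
    qed
    have "(\<lambda>m. f (\<tau> m \<omega>) \<omega> - L \<omega>) \<longlonglongrightarrow> 0"
      by (rule Lim_null_comparison[OF _ LIMSEQ_Suc[OF lim_1_over_n]])
        (use P_\<tau>[OF close] in \<open>auto simp: P_def intro!: always_eventually less_imp_le\<close>)
    then show ?thesis
      by (rule convergentI[OF LIM_zero_cancel])
  qed
  with \<tau>_measurable \<tau>_ge show thesis
    using that by blast
qed

text \<open>The coordinates are treated one after the other, each extraction refining the previous
  one; coordinates that already converge keep doing so along later indices.\<close>

lemma measurable_subsequence_euclidean:
  fixes f :: "nat \<Rightarrow> 'a \<Rightarrow> 'b::euclidean_space"
  assumes f: "\<And>m. f m \<in> borel_measurable N"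
  obtains \<tau> :: "nat \<Rightarrow> 'a \<Rightarrow> nat" where
    "\<And>m. \<tau> m \<in> measurable N (count_space UNIV)"
    "\<And>m \<omega>. m \<le> \<tau> m \<omega>"
    "\<And>\<omega>. bounded (range (\<lambda>m. f m \<omega>)) \<Longrightarrow> convergent (\<lambda>m. f (\<tau> m \<omega>) \<omega>)"
proof -
  have "\<exists>\<tau> :: nat \<Rightarrow> 'a \<Rightarrow> nat. (\<forall>m. \<tau> m \<in> measurable N (count_space UNIV))
      \<and> (\<forall>m \<omega>. m \<le> \<tau> m \<omega>)
      \<and> (\<forall>\<omega>. bounded (range (\<lambda>m. f m \<omega>)) \<longrightarrow> (\<forall>b\<in>J. convergent (\<lambda>m. f (\<tau> m \<omega>) \<omega> \<bullet> b)))"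
    if "finite J" for J :: "'b set"
    using that
  proof (induction J)
    case empty
    show ?case
      by (intro exI[of _ "\<lambda>m \<omega>. m"]) auto
  next
    case (insert b J)
    then obtain \<tau> :: "nat \<Rightarrow> 'a \<Rightarrow> nat" where \<tau>: "\<And>m. \<tau> m \<in> measurable N (count_space UNIV)"
      "\<And>m \<omega>. m \<le> \<tau> m \<omega>"
      "\<And>\<omega> b. bounded (range (\<lambda>m. f m \<omega>)) \<Longrightarrow> b \<in> J \<Longrightarrow> convergent (\<lambda>m. f (\<tau> m \<omega>) \<omega> \<bullet> b)"
      by blast
    have "(\<lambda>\<omega>. f (\<tau> m \<omega>) \<omega> \<bullet> b) \<in> borel_measurable N" for m
      using measurable_random_index[OF f \<tau>(1)] by (intro borel_measurable_inner) auto
    then obtain \<sigma> :: "nat \<Rightarrow> 'a \<Rightarrow> nat" where \<sigma>: "\<And>m. \<sigma> m \<in> measurable N (count_space UNIV)"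
      "\<And>m \<omega>. m \<le> \<sigma> m \<omega>"
      "\<And>\<omega>. bounded (range (\<lambda>m. f (\<tau> m \<omega>) \<omega> \<bullet> b)) \<Longrightarrow>
         convergent (\<lambda>m. f (\<tau> (\<sigma> m \<omega>) \<omega>) \<omega> \<bullet> b)"
      by (rule measurable_subsequence_real[of "\<lambda>m \<omega>. f (\<tau> m \<omega>) \<omega> \<bullet> b" N]) blast
    have "(\<lambda>\<omega>. \<tau> (\<sigma> m \<omega>) \<omega>) \<in> measurable N (count_space UNIV)" for m
      using \<tau>(1) \<sigma>(1) by (rule measurable_compose_countable)
    moreover have "m \<le> \<tau> (\<sigma> m \<omega>) \<omega>" for m \<omega>
      using \<tau>(2) \<sigma>(2) order_trans by blast
    moreover have "convergent (\<lambda>m. f (\<tau> (\<sigma> m \<omega>) \<omega>) \<omega> \<bullet> c)"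
      if bdd: "bounded (range (\<lambda>m. f m \<omega>))" and c: "c \<in> insert b J" for \<omega> c
    proof (cases "c \<in> J")
      case True
      then show ?thesis
        using \<tau>(3)[OF bdd True] tendsto_random_index[of _ _ "\<lambda>m. \<sigma> m \<omega>", OF _ \<sigma>(2)]
        unfolding convergent_def by blast
    next
      case False
      \<comment> \<open>Boundedness is assumed for the original sequence and passes to each
        coordinate and each extraction.\<close>
      have "bounded ((\<lambda>x. x \<bullet> b) ` range (\<lambda>m. f m \<omega>))"
        by (rule bounded_linear_image[OF bdd bounded_linear_inner_left])
      then have "bounded (range (\<lambda>m. f (\<tau> m \<omega>) \<omega> \<bullet> b))"
        by (rule bounded_subset) auto
      then show ?thesis
        using \<sigma>(3) False c by auto
    qed
    ultimately show ?case
      by (intro exI[of _ "\<lambda>m \<omega>. \<tau> (\<sigma> m \<omega>) \<omega>"]) blast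
  qed
  from this[OF finite_Basis] obtain \<tau> :: "nat \<Rightarrow> 'a \<Rightarrow> nat" where
    \<tau>: "\<And>m. \<tau> m \<in> measurable N (count_space UNIV)" "\<And>m \<omega>. m \<le> \<tau> m \<omega>"
      "\<And>\<omega> b. bounded (range (\<lambda>m. f m \<omega>)) \<Longrightarrow> b \<in> Basis \<Longrightarrow> convergent (\<lambda>m. f (\<tau> m \<omega>) \<omega> \<bullet> b)"
    by blast
  have "convergent (\<lambda>m. f (\<tau> m \<omega>) \<omega>)" if "bounded (range (\<lambda>m. f m \<omega>))" for \<omega>
  proof -
    have "\<forall>b\<in>Basis. \<exists>l. (\<lambda>m. f (\<tau> m \<omega>) \<omega> \<bullet> b) \<longlonglongrightarrow> l"
      using \<tau>(3)[OF that] unfolding convergent_def by blast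
    then obtain l where l: "\<And>b. b \<in> Basis \<Longrightarrow> (\<lambda>m. f (\<tau> m \<omega>) \<omega> \<bullet> b) \<longlonglongrightarrow> l b"
      by metis
    have "(\<lambda>m. \<Sum>b\<in>Basis. (f (\<tau> m \<omega>) \<omega> \<bullet> b) *\<^sub>R b) \<longlonglongrightarrow> (\<Sum>b\<in>Basis. l b *\<^sub>R b)"
      by (intro tendsto_sum tendsto_scaleR l tendsto_const)
    then show ?thesis
      unfolding euclidean_representation by (rule convergentI)
  qed
  with \<tau>(1,2) show thesis
    using that by blast
qed

text \<open>Again a first-index search: \<open>\<rho> m\<close> is the first index from
  \<open>m\<close> on at which the norm exceeds \<open>m\<close>.\<close>

lemma measurable_escaping_index:
  fixes f :: "nat \<Rightarrow> 'a \<Rightarrow> 'b::real_normed_vector"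
  assumes [measurable]: "\<And>m. f m \<in> borel_measurable N"
  obtains \<rho> :: "nat \<Rightarrow> 'a \<Rightarrow> nat" where
    "\<And>m. \<rho> m \<in> measurable N (count_space UNIV)"
    "\<And>m \<omega>. m \<le> \<rho> m \<omega>"
    "\<And>m \<omega>. \<not> bounded (range (\<lambda>m. f m \<omega>)) \<Longrightarrow> real m < norm (f (\<rho> m \<omega>) \<omega>)"
proof -
  define P where "P m k \<omega> \<longleftrightarrow> m \<le> k \<and> real m < norm (f k \<omega>)" for m k \<omega>
  have [measurable]: "Measurable.pred N (P m k)" for m k
    unfolding P_def by measurable
  define \<rho> where "\<rho> m \<omega> = (if \<exists>k. P m k \<omega> then LEAST k. P m k \<omega> else m)" for m \<omega>
  have \<rho>_measurable: "\<rho> m \<in> measurable N (count_space UNIV)" for m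
    unfolding \<rho>_def by measurable
  have P_\<rho>: "P m (\<rho> m \<omega>) \<omega>" if "\<exists>k. P m k \<omega>" for m \<omega>
    using that LeastI_ex[OF that] by (simp add: \<rho>_def)
  have \<rho>_ge: "m \<le> \<rho> m \<omega>" for m \<omega>
    using P_\<rho>[of m \<omega>] by (cases "\<exists>k. P m k \<omega>") (auto simp: P_def \<rho>_def)
  have "\<exists>k. P m k \<omega>" if "\<not> bounded (range (\<lambda>m. f m \<omega>))" for m \<omega>
  proof (rule ccontr)
    assume "\<not> ?thesis"
    \<comment> \<open>A failed search leaves only finitely many values, those of index below
      \<open>m\<close>, outside the ball of radius \<open>m\<close>.\<close>
    then have "range (\<lambda>m. f m \<omega>) \<subseteq> (\<lambda>k. f k \<omega>) ` {..<m} \<union> cball 0 (real m)"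
      unfolding P_def by (auto simp: not_le not_less image_iff)
    then have "bounded (range (\<lambda>m. f m \<omega>))"
      by (rule bounded_subset[rotated]) (simp add: finite_imp_bounded)
    with that show False ..
  qed
  then have "real m < norm (f (\<rho> m \<omega>) \<omega>)" if "\<not> bounded (range (\<lambda>m. f m \<omega>))" for m \<omega>
    using that P_\<rho>[of m \<omega>] by (simp add: P_def)
  with \<rho>_measurable \<rho>_ge show thesis
    by (rule that)
qed

text \<open>Taking the bound among the natural numbers makes the existential quantifier
  countable.\<close>

lemma sets_bounded_range:
  fixes f :: "nat \<Rightarrow> 'a \<Rightarrow> 'b::real_normed_vector"
  assumes [measurable]: "\<And>m. f m \<in> borel_measurable N"
  shows "{\<omega> \<in> space N. bounded (range (\<lambda>m. f m \<omega>))} \<in> sets N"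
proof -
  have "bounded (range (\<lambda>m. f m \<omega>)) \<longleftrightarrow> (\<exists>C::nat. \<forall>m. norm (f m \<omega>) \<le> real C)" for \<omega>
    unfolding bounded_iff by simp (meson order_trans real_arch_simple)
  moreover have "{\<omega> \<in> space N. \<exists>C::nat. \<forall>m. norm (f m \<omega>) \<le> real C} \<in> sets N"
    by measurable
  ultimately show ?thesis
    by simp
qed

section \<open>From convergence in probability to almost sure convergence\<close>

text \<open>Borel-Cantelli: \<open>\<rho> k\<close> makes a deviation above \<open>(1/2)^k\<close>
  less likely than \<open>(1/2)^k\<close>, so almost surely only finitely many such deviations
  occur.\<close>

lemma converges_in_prob_imp_AE_subseq:
  assumes "prob_space M"
    and X [measurable]: "\<And>n. X n \<in> borel_measurable M" and Y [measurable]: "Y \<in> borel_measurable M"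
    and conv: "converges_in_prob M X Y"
  obtains \<rho> :: "nat \<Rightarrow> nat" where "AE \<omega> in M. (\<lambda>k. X (\<rho> k) \<omega>) \<longlonglongrightarrow> Y \<omega>"
proof -
  interpret prob_space M by fact
  have "\<exists>n. measure M {\<omega> \<in> space M. (1/2)^k < \<bar>X n \<omega> - Y \<omega>\<bar>} < (1/2)^k" for k
  proof -
    have "(\<lambda>n. measure M {\<omega> \<in> space M. (1/2)^k < \<bar>X n \<omega> - Y \<omega>\<bar>}) \<longlonglongrightarrow> 0"
      using conv unfolding converges_in_prob_def by auto
    from order_tendstoD(2)[OF this, of "(1/2)^k"] show ?thesis
      by (auto simp: eventually_sequentially)
  qed
  then obtain \<rho> where \<rho>: "\<And>k. measure M {\<omega> \<in> space M. (1/2)^k < \<bar>X (\<rho> k) \<omega> - Y \<omega>\<bar>} < (1/2)^k"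
    by metis
  have "AE \<omega> in M. \<forall>\<^sub>F k in sequentially.
      \<omega> \<in> space M - {\<omega> \<in> space M. (1/2)^k < \<bar>X (\<rho> k) \<omega> - Y \<omega>\<bar>}"
  proof (rule borel_cantelli_AE1)
    show "summable (\<lambda>k. measure M {\<omega> \<in> space M. (1/2)^k < \<bar>X (\<rho> k) \<omega> - Y \<omega>\<bar>})"
      using \<rho> by (intro summable_comparison_test'[OF summable_geometric[of "1/2::real"]])
        (auto intro: less_imp_le)
  qed (auto simp: emeasure_eq_measure)
  then have "AE \<omega> in M. (\<lambda>k. X (\<rho> k) \<omega>) \<longlonglongrightarrow> Y \<omega>"
  proof eventually_elim
    case (elim \<omega>)
    have "(\<lambda>k. X (\<rho> k) \<omega> - Y \<omega>) \<longlonglongrightarrow> 0"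
      by (rule Lim_null_comparison[OF eventually_mono[OF elim] LIMSEQ_abs_realpow_zero2[of "1/2"]]) auto
    then show ?case
      by (rule LIM_zero_cancel)
  qed
  then show thesis
    by (rule that)
qed

subsection \<open>Limits of positions\<close>

lemma (in filtration) measurable_F_mono:
  assumes "f \<in> measurable (F i) A" "i \<le> j"
  shows "f \<in> measurable (F j) A"
  using assms sets_F_mono[OF assms(2)] unfolding measurable_def by (auto simp: space_F)

text \<open>
  Positions before \<open>t\<close> are only \<open>F (t - 1)\<close>-measurable, since the random subsequences
  extracted along the way depend on information up to \<open>t - 1\<close>.
\<close>

lemma limit_dominated_by_gain:
  fixes G :: "'a \<Rightarrow> (nat \<Rightarrow> 'b::euclidean_space) \<Rightarrow> real"
  assumes filt: "filtration (space M) F"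
    and cont: "\<And>\<omega> x y. \<omega> \<in> space M \<Longrightarrow> (\<And>s. s \<in> {1..T} \<Longrightarrow> (\<lambda>m. x m s) \<longlonglongrightarrow> y s) \<Longrightarrow>
      (\<lambda>m. G \<omega> (x m)) \<longlonglongrightarrow> G \<omega> y"
    and hom: "\<And>\<omega> c x. 0 \<le> c \<Longrightarrow> G \<omega> (\<lambda>s. c *\<^sub>R x s) = c * G \<omega> x"
    and no_arb: "\<And>h s. (\<And>s. s \<in> {1..T} \<Longrightarrow> h s \<in> borel_measurable (F (s - 1))) \<Longrightarrow>
      AE \<omega> in M. 0 \<le> G \<omega> (\<lambda>s. h s \<omega>) \<Longrightarrow> s \<in> {1..T} \<Longrightarrow> AE \<omega> in M. h s \<omega> = 0"
    and "1 \<le> t" "t \<le> Suc T"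
    and "\<And>m s. s \<in> {1..T} \<Longrightarrow> h m s \<in> borel_measurable (F (max s t - 1))"
    and "\<And>s. s \<in> {1..<t} \<Longrightarrow> l s \<in> borel_measurable (F (s - 1))"
    and "\<And>s. s \<in> {1..<t} \<Longrightarrow> AE \<omega> in M. (\<lambda>m. h m s \<omega>) \<longlonglongrightarrow> l s \<omega>"
    and "AE \<omega> in M. (\<lambda>m. Z m \<omega>) \<longlonglongrightarrow> W \<omega>"
    and "\<And>m. AE \<omega> in M. Z m \<omega> \<le> G \<omega> (\<lambda>s. h m s \<omega>)"
  shows "\<exists>g. (\<forall>s\<in>{1..T}. g s \<in> borel_measurable (F (s - 1))) \<and> (\<forall>s\<in>{1..<t}. g s = l s) \<and>
    (AE \<omega> in M. W \<omega> \<le> G \<omega> (\<lambda>s. g s \<omega>))"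
  using assms(6-)
\<comment> \<open>The induction descends from \<open>Suc T\<close>, where all positions already
  converge, to \<open>t\<close>. The sequences, limits and bounds stay arbitrary because the
  hypothesis is applied both to rescaled and to unscaled positions.\<close>
proof (induction t arbitrary: h l Z W rule: inc_induct)
  case base
  have "AE \<omega> in M. \<forall>s\<in>{1..T}. (\<lambda>m. h m s \<omega>) \<longlonglongrightarrow> l s \<omega>"
    using base(3) by (intro AE_finite_allI) auto
  moreover have "AE \<omega> in M. \<forall>m. Z m \<omega> \<le> G \<omega> (\<lambda>s. h m s \<omega>)"
    using base(5) by (simp add: AE_all_countable)
  ultimately have "AE \<omega> in M. W \<omega> \<le> G \<omega> (\<lambda>s. l s \<omega>)"
    using base(4) AE_space
  proof eventually_elim
    case (elim \<omega>)
    then have "(\<lambda>m. G \<omega> (\<lambda>s. h m s \<omega>)) \<longlonglongrightarrow> G \<omega> (\<lambda>s. l s \<omega>)"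
      by (intro cont) auto
    with elim show ?case
      by (intro LIMSEQ_le[of "\<lambda>m. Z m \<omega>"]) auto
  qed
  then show ?case
    using base(2) by (intro exI[of _ l]) auto
next
  case (step n)
  interpret filtration "space M" F by (rule filt)
  have n: "n \<in> {1..T}"
    using step.hyps \<open>1 \<le> t\<close> by auto
  \<comment> \<open>The information available when the position for date \<open>n\<close> is chosen;
    every random index of this step is measurable for it.\<close>
  define N where "N = F (n - 1)"
  have N_mono: "f \<in> measurable (F j) A" if "f \<in> measurable N A" "n - 1 \<le> j" for f j and A :: "'c measure"
    using that measurable_F_mono unfolding N_def by blast
  have h_n: "h m n \<in> borel_measurable N" for m
    using step.prems(1)[OF n] by (simp add: N_def)
  define bdd where "bdd \<omega> = bounded (range (\<lambda>m. h m n \<omega>))" for \<omega>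
  have bdd_N [measurable]: "Measurable.pred N bdd"
    using sets_bounded_range[OF h_n] unfolding pred_def bdd_def .
  have le: "AE \<omega> in M. \<forall>m. Z m \<omega> \<le> G \<omega> (\<lambda>s. h m s \<omega>)"
    using step.prems(5) by (simp add: AE_all_countable)
  \<comment> \<open>A random index adds its own information to past positions, so dates up to
    \<open>n\<close> are only measured by \<open>F n\<close>; a later date \<open>s\<close> keeps
    \<open>F (s - 1)\<close>, which contains \<open>N\<close>.\<close>
  have h_index: "(\<lambda>\<omega>. h (\<tau> \<omega>) s \<omega>) \<in> borel_measurable (F (max s (Suc n) - 1))"
    if "\<tau> \<in> measurable N (count_space UNIV)" "s \<in> {1..T}" for \<tau> s
  proof (rule measurable_random_index[where f = "\<lambda>m. h m s"])
    show "h m s \<in> borel_measurable (F (max s (Suc n) - 1))" for m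
      by (rule measurable_F_mono[OF step.prems(1)[OF that(2)]]) auto
    show "\<tau> \<in> measurable (F (max s (Suc n) - 1)) (count_space UNIV)"
      using that(1) by (rule N_mono) auto
  qed

  \<comment> \<open>The induction hypothesis also applies to the rescaled sequence, which is where \<open>no_arb\<close> enters.\<close>
  have AE_bdd: "AE \<omega> in M. bdd \<omega>"
  proof -
    obtain \<rho> :: "nat \<Rightarrow> 'a \<Rightarrow> nat" where \<rho>: "\<And>m. \<rho> m \<in> measurable N (count_space UNIV)"
      "\<And>m \<omega>. m \<le> \<rho> m \<omega>" "\<And>m \<omega>. \<not> bdd \<omega> \<Longrightarrow> real m < norm (h (\<rho> m \<omega>) n \<omega>)"
      unfolding bdd_def by (rule measurable_escaping_index[of "\<lambda>m. h m n" N, OF h_n]) blast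
    have h_\<rho> [measurable]: "(\<lambda>\<omega>. h (\<rho> m \<omega>) n \<omega>) \<in> borel_measurable N" for m
      by (rule measurable_random_index[of "\<lambda>m. h m n" N, OF h_n \<rho>(1)])
    \<comment> \<open>This scaling gives the position at date \<open>n\<close> norm 1 exactly where
      the sequence is unbounded and kills it elsewhere. Since the norm there exceeds
      \<open>m\<close>, the factors tend to 0.\<close>
    define a where "a m \<omega> = (if bdd \<omega> then 0 else 1 / norm (h (\<rho> m \<omega>) n \<omega>))" for m \<omega>
    have a_N [measurable]: "a m \<in> borel_measurable N" for m
      unfolding a_def by measurable
    have a_nonneg: "0 \<le> a m \<omega>" for m \<omega>
      by (simp add: a_def)
    have a_lim: "(\<lambda>m. a m \<omega>) \<longlonglongrightarrow> 0" for \<omega>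
    proof (rule Lim_null_comparison[OF _ lim_1_over_n])
      show "\<forall>\<^sub>F m in sequentially. norm (a m \<omega>) \<le> 1 / real m"
        using eventually_gt_at_top[of 0]
      proof eventually_elim
        case (elim m)
        then show ?case
          using \<rho>(3)[of \<omega> m] by (auto simp: a_def intro!: frac_le)
      qed
    qed
    define f where "f m \<omega> = a m \<omega> *\<^sub>R h (\<rho> m \<omega>) n \<omega>" for m \<omega>
    have f_N: "f m \<in> borel_measurable N" for m
      unfolding f_def by measurable
    have norm_f: "norm (f m \<omega>) = (if bdd \<omega> then 0 else 1)" for m \<omega>
      using \<rho>(3)[of \<omega> m] by (cases "bdd \<omega>") (auto simp: f_def a_def)
    then have f_bdd: "bounded (range (\<lambda>m. f m \<omega>))" for \<omega>
      unfolding bounded_iff by (intro exI[of _ 1]) auto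
    obtain \<sigma> :: "nat \<Rightarrow> 'a \<Rightarrow> nat" where \<sigma>: "\<And>m. \<sigma> m \<in> measurable N (count_space UNIV)"
      "\<And>m \<omega>. m \<le> \<sigma> m \<omega>" "\<And>\<omega>. convergent (\<lambda>m. f (\<sigma> m \<omega>) \<omega>)"
      by (rule measurable_subsequence_euclidean[of f N, OF f_N]) (use f_bdd in blast)
    define u where "u \<omega> = lim (\<lambda>m. f (\<sigma> m \<omega>) \<omega>)" for \<omega>
    have u: "(\<lambda>m. f (\<sigma> m \<omega>) \<omega>) \<longlonglongrightarrow> u \<omega>" for \<omega>
      using \<sigma>(3) unfolding u_def convergent_LIMSEQ_iff by blast
    have u_N: "u \<in> borel_measurable N"
      by (rule borel_measurable_LIMSEQ_metric[OF measurable_random_index[of f N, OF f_N \<sigma>(1)] u])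
    have norm_u: "norm (u \<omega>) = 1" if "\<not> bdd \<omega>" for \<omega>
      using tendsto_norm[OF u[of \<omega>]] that by (simp add: norm_f LIMSEQ_const_iff)
    define \<tau> where "\<tau> m \<omega> = \<rho> (\<sigma> m \<omega>) \<omega>" for m \<omega>
    have \<tau>_N: "\<tau> m \<in> measurable N (count_space UNIV)" for m
      unfolding \<tau>_def using \<rho>(1) \<sigma>(1) by (rule measurable_compose_countable)
    have \<tau>_ge: "m \<le> \<tau> m \<omega>" for m \<omega>
      unfolding \<tau>_def using \<rho>(2) \<sigma>(2) order_trans by blast
    define c where "c m \<omega> = a (\<sigma> m \<omega>) \<omega>" for m \<omega>
    have c_N: "c m \<in> borel_measurable N" for m
      unfolding c_def by (rule measurable_random_index[of a N, OF a_N \<sigma>(1)])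
    have c_nonneg: "0 \<le> c m \<omega>" for m \<omega>
      by (simp add: c_def a_nonneg)
    have c_lim: "(\<lambda>m. c m \<omega>) \<longlonglongrightarrow> 0" for \<omega>
      unfolding c_def using a_lim \<sigma>(2) by (rule tendsto_random_index)
    \<comment> \<open>Under the vanishing factors \<open>c\<close>, the convergent past and the
      lower bounds \<open>Z\<close> tend to 0, while the position at date \<open>n\<close> tends to
      \<open>u\<close>.\<close>
    have "\<exists>g. (\<forall>s\<in>{1..T}. g s \<in> borel_measurable (F (s - 1))) \<and>
        (\<forall>s\<in>{1..<Suc n}. g s = (if s = n then u else (\<lambda>\<omega>. 0))) \<and>
        (AE \<omega> in M. 0 \<le> G \<omega> (\<lambda>s. g s \<omega>))"
    proof (rule step.IH[where h = "\<lambda>m s \<omega>. c m \<omega> *\<^sub>R h (\<tau> m \<omega>) s \<omega>"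
          and Z = "\<lambda>m \<omega>. c m \<omega> * Z (\<tau> m \<omega>) \<omega>"])
      show "(\<lambda>\<omega>. c m \<omega> *\<^sub>R h (\<tau> m \<omega>) s \<omega>) \<in> borel_measurable (F (max s (Suc n) - 1))"
        if "s \<in> {1..T}" for m s
        using h_index[OF \<tau>_N that] N_mono[OF c_N] by (intro borel_measurable_scaleR) auto
      show "(if s = n then u else (\<lambda>\<omega>. 0)) \<in> borel_measurable (F (s - 1))" for s
        using u_N by (auto simp: N_def)
      show "AE \<omega> in M. (\<lambda>m. c m \<omega> *\<^sub>R h (\<tau> m \<omega>) s \<omega>) \<longlonglongrightarrow> (if s = n then u else (\<lambda>\<omega>. 0)) \<omega>"
        if "s \<in> {1..<Suc n}" for s
      proof (cases "s = n")
        case True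
        then show ?thesis
          using u by (simp add: f_def c_def \<tau>_def)
      next
        case False
        with that have "s \<in> {1..<n}"
          by auto
        from step.prems(3)[OF this] show ?thesis
        proof eventually_elim
          case (elim \<omega>)
          show ?case
            using tendsto_scaleR[OF c_lim tendsto_random_index[OF elim \<tau>_ge]] False by simp
        qed
      qed
      show "AE \<omega> in M. (\<lambda>m. c m \<omega> * Z (\<tau> m \<omega>) \<omega>) \<longlonglongrightarrow> 0"
        using step.prems(4)
      proof eventually_elim
        case (elim \<omega>)
        show ?case
          using tendsto_mult[OF c_lim tendsto_random_index[OF elim \<tau>_ge]] by simp
      qed
      show "AE \<omega> in M. c m \<omega> * Z (\<tau> m \<omega>) \<omega> \<le> G \<omega> (\<lambda>s. c m \<omega> *\<^sub>R h (\<tau> m \<omega>) s \<omega>)" for m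
        using le
      proof eventually_elim
        case (elim \<omega>)
        then show ?case
          by (simp add: hom[OF c_nonneg] mult_left_mono[OF _ c_nonneg])
      qed
    qed
    then obtain g where g: "\<And>s. s \<in> {1..T} \<Longrightarrow> g s \<in> borel_measurable (F (s - 1))"
      "\<And>s. s \<in> {1..<Suc n} \<Longrightarrow> g s = (if s = n then u else (\<lambda>\<omega>. 0))"
      "AE \<omega> in M. 0 \<le> G \<omega> (\<lambda>s. g s \<omega>)"
      by blast
    \<comment> \<open>Since \<open>u\<close> has norm 1 wherever \<open>bdd\<close> fails, its
      vanishing makes that set null.\<close>
    have "AE \<omega> in M. u \<omega> = 0"
      using no_arb[OF g(1) g(3) n] g(2)[of n] n by simp
    then show ?thesis
    proof eventually_elim
      case (elim \<omega>)
      then show ?case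
        using norm_u[of \<omega>] by fastforce
    qed
  qed

  obtain \<tau> :: "nat \<Rightarrow> 'a \<Rightarrow> nat" where \<tau>: "\<And>m. \<tau> m \<in> measurable N (count_space UNIV)"
    "\<And>m \<omega>. m \<le> \<tau> m \<omega>" "\<And>\<omega>. bdd \<omega> \<Longrightarrow> convergent (\<lambda>m. h (\<tau> m \<omega>) n \<omega>)"
    unfolding bdd_def by (rule measurable_subsequence_euclidean[of "\<lambda>m. h m n" N, OF h_n]) blast
  \<comment> \<open>Setting the positions to 0 on the null set where \<open>bdd\<close> fails makes
    date \<open>n\<close> converge at every point, so \<open>u\<close> is measurable for
    \<open>N\<close> itself and not just up to null sets.\<close>
  define k where "k m s \<omega> = (if bdd \<omega> then h (\<tau> m \<omega>) s \<omega> else 0)" for m s \<omega>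
  define u where "u \<omega> = lim (\<lambda>m. k m n \<omega>)" for \<omega>
  have u: "(\<lambda>m. k m n \<omega>) \<longlonglongrightarrow> u \<omega>" for \<omega>
    using \<tau>(3)[of \<omega>] unfolding u_def k_def by (cases "bdd \<omega>") (auto simp: convergent_LIMSEQ_iff)
  have k_n: "k m n \<in> borel_measurable N" for m
    unfolding k_def using measurable_random_index[of "\<lambda>m. h m n" N, OF h_n \<tau>(1), measurable] by measurable
  have u_N: "u \<in> borel_measurable N"
    by (rule borel_measurable_LIMSEQ_metric[of "\<lambda>m. k m n", OF k_n u])
  \<comment> \<open>Now the hypothesis is applied to the unscaled positions: the past keeps its
    limits \<open>l\<close>, and date \<open>n\<close> contributes \<open>u\<close>.\<close>
  have "\<exists>g. (\<forall>s\<in>{1..T}. g s \<in> borel_measurable (F (s - 1))) \<and>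
      (\<forall>s\<in>{1..<Suc n}. g s = (if s = n then u else l s)) \<and>
      (AE \<omega> in M. W \<omega> \<le> G \<omega> (\<lambda>s. g s \<omega>))"
  proof (rule step.IH[where h = k and Z = "\<lambda>m \<omega>. Z (\<tau> m \<omega>) \<omega>"])
    show "k m s \<in> borel_measurable (F (max s (Suc n) - 1))" if "s \<in> {1..T}" for m s
    proof -
      have "Measurable.pred (F (max s (Suc n) - 1)) bdd"
        using bdd_N by (rule N_mono) auto
      then show ?thesis
        unfolding k_def using h_index[OF \<tau>(1) that, measurable] by measurable
    qed
    show "(if s = n then u else l s) \<in> borel_measurable (F (s - 1))" if "s \<in> {1..<Suc n}" for s
      using u_N step.prems(2)[of s] that by (auto simp: N_def)
    show "AE \<omega> in M. (\<lambda>m. k m s \<omega>) \<longlonglongrightarrow> (if s = n then u else l s) \<omega>"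
      if "s \<in> {1..<Suc n}" for s
    proof (cases "s = n")
      case True
      then show ?thesis
        using u by simp
    next
      case False
      with that have "s \<in> {1..<n}"
        by auto
      from step.prems(3)[OF this] AE_bdd show ?thesis
      proof eventually_elim
        case (elim \<omega>)
        show ?case
          using tendsto_random_index[OF elim(1) \<tau>(2)] elim(2) False by (simp add: k_def)
      qed
    qed
    show "AE \<omega> in M. (\<lambda>m. Z (\<tau> m \<omega>) \<omega>) \<longlonglongrightarrow> W \<omega>"
      using step.prems(4)
    proof eventually_elim
      case (elim \<omega>)
      show ?case
        using tendsto_random_index[OF elim \<tau>(2)] .
    qed
    show "AE \<omega> in M. Z (\<tau> m \<omega>) \<omega> \<le> G \<omega> (\<lambda>s. k m s \<omega>)" for m
      using le AE_bdd
    proof eventually_elim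
      case (elim \<omega>)
      then show ?case
        by (simp add: k_def)
    qed
  qed
  then obtain g where g: "\<And>s. s \<in> {1..T} \<Longrightarrow> g s \<in> borel_measurable (F (s - 1))"
    "\<And>s. s \<in> {1..<Suc n} \<Longrightarrow> g s = (if s = n then u else l s)"
    "AE \<omega> in M. W \<omega> \<le> G \<omega> (\<lambda>s. g s \<omega>)"
    by blast
  have "g s = l s" if "s \<in> {1..<n}" for s
    using g(2)[of s] that by auto
  with g(1,3) show ?case
    by blast
qed

subsection \<open>Gains in the bid-ask market\<close>

text \<open>The jump of the price at position 0 is multiplied by 0; in terms of positive and
  negative parts, continuity and measurability are evident.\<close>

lemma two_sided_eq_max_min:
  "two_sided x p q = (\<Sum>j\<in>UNIV. max 0 (x $ j) * p $ j + min 0 (x $ j) * q $ j)"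
  unfolding two_sided_def by (intro sum.cong) (auto simp: max_def min_def)

lemma tendsto_two_sided:
  "(f \<longlongrightarrow> x) \<F> \<Longrightarrow> ((\<lambda>m. two_sided (f m) p q) \<longlongrightarrow> two_sided x p q) \<F>"
  unfolding two_sided_eq_max_min by (intro tendsto_intros)

text \<open>A positive factor preserves the sign of each position, hence the price applied to it;
  for \<open>c = 0\<close> both sides vanish.\<close>

lemma two_sided_scaleR:
  assumes "0 \<le> c"
  shows "two_sided (c *\<^sub>R x) p q = c * two_sided x p q"
  unfolding two_sided_def sum_distrib_left
  using assms by (intro sum.cong) (auto simp: zero_le_mult_iff)

lemma borel_measurable_two_sided [measurable (raw)]:
  assumes "f \<in> borel_measurable N" "p \<in> borel_measurable N" "q \<in> borel_measurable N"
  shows "(\<lambda>\<omega>. two_sided (f \<omega>) (p \<omega>) (q \<omega>)) \<in> borel_measurable N"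
proof -
  have nth: "(\<lambda>\<omega>. g \<omega> $ j) \<in> borel_measurable N" if "g \<in> borel_measurable N"
    for g :: "'a \<Rightarrow> real ^ 'n" and j
    using that by (rule borel_measurable_continuous_on[rotated]) (intro continuous_intros)
  note [measurable] = assms[THEN nth]
  show ?thesis
    unfolding two_sided_eq_max_min by measurable
qed

context bid_ask_market
begin

text \<open>\<open>cash \<omega> x n\<close> is the savings account position \<open>\<phi>\<^sup>0\<close> at date \<open>n + 1\<close>.\<close>

primrec cash :: "'a \<Rightarrow> (nat \<Rightarrow> real ^ 'n) \<Rightarrow> nat \<Rightarrow> real" where
  "cash \<omega> x 0 = - two_sided (x 1) (P_ask 0 \<omega>) (P_bid 0 \<omega>)"
| "cash \<omega> x (Suc n) = cash \<omega> x n +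
    (two_sided (x (Suc n)) (A_ask (Suc n) \<omega> - A_ask n \<omega>) (A_bid (Suc n) \<omega> - A_bid n \<omega>)
     - two_sided (x (Suc (Suc n)) - x (Suc n)) (P_ask (Suc n) \<omega>) (P_bid (Suc n) \<omega>)) / B (Suc n) \<omega>"

text \<open>The discounted terminal value, as a function of the risky path at a fixed
  \<open>\<omega>\<close>, so that continuity and homogeneity become pathwise statements. The index
  \<open>T - 1\<close> refers to the savings position held at date \<open>T\<close>.\<close>

definition gain :: "'a \<Rightarrow> (nat \<Rightarrow> real ^ 'n) \<Rightarrow> real" where
  "gain \<omega> x = (cash \<omega> x (T - 1) * B T \<omega> + two_sided (x T) (P_bid T \<omega>) (P_ask T \<omega>)
     + two_sided (x T) (A_ask T \<omega> - A_ask (T - 1) \<omega>) (A_bid T \<omega> - A_bid (T - 1) \<omega>)) / B T \<omega>"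

definition predictable :: "(nat \<Rightarrow> 'a \<Rightarrow> real ^ 'n) \<Rightarrow> bool" where
  "predictable h \<longleftrightarrow> (\<forall>s\<in>{1..T}. h s \<in> borel_measurable (F (s - 1)))"

definition strategy :: "(nat \<Rightarrow> 'a \<Rightarrow> real ^ 'n) \<Rightarrow> nat \<Rightarrow> 'a \<Rightarrow> real \<times> (real ^ 'n)" where
  "strategy h t \<omega> = (if t = 0 then 0 else (cash \<omega> (\<lambda>s. h s \<omega>) (t - 1), h t \<omega>))"

lemma tendsto_cash:
  assumes "\<And>s. s \<in> {1..T} \<Longrightarrow> (\<lambda>m. x m s) \<longlonglongrightarrow> y s" "n < T"
  shows "(\<lambda>m. cash \<omega> (x m) n) \<longlonglongrightarrow> cash \<omega> y n"
  using assms(2)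
proof (induction n)
  case 0
  show ?case
    using T_ge_1 unfolding cash.simps by (intro tendsto_minus tendsto_two_sided assms(1)) auto
next
  case (Suc n)
  then show ?case
    \<comment> \<open>As multiplication by a constant, the division is continuous in the path at
      every \<open>\<omega>\<close>, even where \<open>B\<close> vanishes.\<close>
    unfolding cash.simps divide_inverse
    by (intro tendsto_add tendsto_mult tendsto_diff tendsto_two_sided tendsto_const assms(1)) auto
qed

lemma tendsto_gain:
  assumes "\<And>s. s \<in> {1..T} \<Longrightarrow> (\<lambda>m. x m s) \<longlonglongrightarrow> y s"
  shows "(\<lambda>m. gain \<omega> (x m)) \<longlonglongrightarrow> gain \<omega> y"
  unfolding gain_def divide_inverse using T_ge_1
  by (intro tendsto_add tendsto_mult tendsto_two_sided tendsto_const tendsto_cash assms) auto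

lemma cash_scaleR:
  assumes "0 \<le> c"
  shows "cash \<omega> (\<lambda>s. c *\<^sub>R x s) n = c * cash \<omega> x n"
proof (induction n)
  case (Suc n)
  show ?case
    by (simp add: Suc two_sided_scaleR[OF assms] flip: scaleR_diff_right) (simp add: field_simps)
qed (simp add: two_sided_scaleR[OF assms])

lemma gain_scaleR: "0 \<le> c \<Longrightarrow> gain \<omega> (\<lambda>s. c *\<^sub>R x s) = c * gain \<omega> x"
  unfolding gain_def by (simp add: cash_scaleR two_sided_scaleR) (simp add: field_simps)

section \<open>Positivity and measurability of the market processes\<close>

lemma AE_B_pos: "AE \<omega> in M. \<forall>t\<in>{..T}. 0 < B t \<omega>"
proof -
  have "AE \<omega> in M. \<forall>t\<in>{..T}. 0 \<le> r t \<omega>"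
    using r_nonneg by (intro AE_finite_allI) auto
  then show ?thesis
  proof eventually_elim
    case (elim \<omega>)
    then show ?case
      unfolding B_def by (auto intro!: prod_pos add_pos_nonneg)
  qed
qed

lemma B_measurable:
  assumes "t \<le> T"
  shows "B t \<in> borel_measurable (F t)"
proof -
  have "r s \<in> borel_measurable (F t)" if "s \<in> {0..t}" for s
    using measurable_F_mono[OF r_adapted] that assms by auto
  then show ?thesis
    unfolding B_def by (intro borel_measurable_prod borel_measurable_add) auto
qed

lemma dividend_increment_measurable:
  assumes "1 \<le> t" "t \<le> T"
  shows "(\<lambda>\<omega>. A_ask t \<omega> - A_ask (t - 1) \<omega>) \<in> borel_measurable (F t)"
    and "(\<lambda>\<omega>. A_bid t \<omega> - A_bid (t - 1) \<omega>) \<in> borel_measurable (F t)"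
proof -
  have "A_ask (t - 1) \<in> borel_measurable (F t)" "A_bid (t - 1) \<in> borel_measurable (F t)"
    using assms measurable_F_mono[OF A_ask_adapted[of "t - 1"], of t]
      measurable_F_mono[OF A_bid_adapted[of "t - 1"], of t]
    \<comment> \<open>Adaptedness of the dividends starts at date 1; at \<open>t = 1\<close> the
      previous value is the convention 0.\<close>
    by (cases "t = 1"; simp add: A_ask_0 A_bid_0)+
  then show "(\<lambda>\<omega>. A_ask t \<omega> - A_ask (t - 1) \<omega>) \<in> borel_measurable (F t)"
    and "(\<lambda>\<omega>. A_bid t \<omega> - A_bid (t - 1) \<omega>) \<in> borel_measurable (F t)"
    using assms A_ask_adapted A_bid_adapted by (auto intro: borel_measurable_diff)
qed

text \<open>As \<open>cash\<close> at \<open>n\<close> is the savings position for date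
  \<open>n + 1\<close>, measurability for \<open>F n\<close> is its predictability.\<close>

lemma cash_measurable:
  assumes h: "predictable h" and "n < T"
  shows "(\<lambda>\<omega>. cash \<omega> (\<lambda>s. h s \<omega>) n) \<in> borel_measurable (F n)"
  using assms(2)
proof (induction n)
  case 0
  have "h 1 \<in> borel_measurable (F 0)"
    using h T_ge_1 unfolding predictable_def by force
  then show ?case
    using P_ask_adapted[of 0] P_bid_adapted[of 0] by simp
next
  case (Suc n)
  have "h (Suc n) \<in> borel_measurable (F n)"
    and [measurable]: "h (Suc (Suc n)) \<in> borel_measurable (F (Suc n))"
    using h Suc.prems unfolding predictable_def by force+
  from this(1) have [measurable]: "h (Suc n) \<in> borel_measurable (F (Suc n))"
    by (rule measurable_F_mono) simp
  have [measurable]: "(\<lambda>\<omega>. cash \<omega> (\<lambda>s. h s \<omega>) n) \<in> borel_measurable (F (Suc n))"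
    using Suc.IH[OF Suc_lessD[OF Suc.prems]] by (rule measurable_F_mono) simp
  show ?case
    using Suc.prems dividend_increment_measurable[of "Suc n"] B_measurable[of "Suc n"]
      P_ask_adapted[of "Suc n"] P_bid_adapted[of "Suc n"]
    by simp
qed

section \<open>Correspondence between strategies of zero cost and risky positions\<close>

text \<open>The recursion for \<open>cash\<close> is the self-financing equation solved for the next
  savings position, which is legitimate where \<open>B\<close> is positive.\<close>

lemma strategy_mem_S:
  assumes h: "predictable h"
  shows "strategy h \<in> S"
proof -
  have "strategy h t \<in> borel_measurable (F (t - 1))" if "t \<in> {1..T}" for t
    using that h cash_measurable[OF h, of "t - 1"]
    unfolding strategy_def predictable_def by (auto intro!: borel_measurable_Pair)
  then have "trading_strategy (strategy h)"
    unfolding trading_strategy_def by (auto simp: strategy_def)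
  moreover have "self_financing (strategy h)"
    unfolding self_financing_def
  proof
    fix t assume t: "t \<in> {1..T - 1}"
    then obtain n where n: "t = Suc n"
      by (cases t) auto
    show "AE \<omega> in M. B t \<omega> * (fst (strategy h (t + 1) \<omega>) - fst (strategy h t \<omega>))
        + two_sided (snd (strategy h (t + 1) \<omega>) - snd (strategy h t \<omega>)) (P_ask t \<omega>) (P_bid t \<omega>)
        = dividends (strategy h) t \<omega>"
      using AE_B_pos
    proof eventually_elim
      case (elim \<omega>)
      with t have "0 < B t \<omega>"
        by auto
      then show ?case
        by (simp add: strategy_def dividends_def n)
    qed
  qed
  ultimately show ?thesis
    by (simp add: S_def)
qed

lemma V_strategy_0: "V (strategy h) 0 \<omega> = 0"
  by (simp add: V_def strategy_def)

lemma V_disc_strategy: "V_disc (strategy h) T = (\<lambda>\<omega>. gain \<omega> (\<lambda>s. h s \<omega>))"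
  using T_ge_1 by (simp add: fun_eq_iff V_disc_def V_def gain_def strategy_def dividends_def)

text \<open>Zero initial cost fixes the first savings position and the self-financing equation every
  later one, so almost surely the savings component must be \<open>cash\<close>.\<close>

lemma V_disc_eq_gain:
  assumes "\<phi> \<in> S" and V0: "AE \<omega> in M. V \<phi> 0 \<omega> = 0"
  shows "AE \<omega> in M. V_disc \<phi> T \<omega> = gain \<omega> (\<lambda>s. snd (\<phi> s \<omega>))"
proof -
  have "AE \<omega> in M. \<forall>t\<in>{1..T - 1}.
      B t \<omega> * (fst (\<phi> (t + 1) \<omega>) - fst (\<phi> t \<omega>))
      + two_sided (snd (\<phi> (t + 1) \<omega>) - snd (\<phi> t \<omega>)) (P_ask t \<omega>) (P_bid t \<omega>)
      = dividends \<phi> t \<omega>"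
    using assms(1) unfolding S_def self_financing_def by (intro AE_finite_allI) auto
  then show ?thesis
    using V0 AE_B_pos
  proof eventually_elim
    case (elim \<omega>)
    have "fst (\<phi> (Suc n) \<omega>) = cash \<omega> (\<lambda>s. snd (\<phi> s \<omega>)) n" if "n < T" for n
      using that
    proof (induction n)
      case 0
      show ?case
        using elim(2) by (simp add: V_def)
    next
      case (Suc n)
      then have "Suc n \<in> {1..T - 1}" and "B (Suc n) \<omega> \<noteq> 0"
        using elim(3)[rule_format, of "Suc n"] by auto
      with elim(1)[rule_format, OF this(1)] Suc show ?case
        by (simp add: dividends_def field_simps)
    qed
    from this[of "T - 1"] show ?case
      using T_ge_1 by (simp add: V_disc_def V_def gain_def dividends_def)
  qed
qed

lemma predictable_snd:
  assumes "\<phi> \<in> S"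
  shows "predictable (\<lambda>s \<omega>. snd (\<phi> s \<omega>))"
proof -
  have "\<phi> s \<in> borel_measurable (F (s - 1))" if "s \<in> {1..T}" for s
    using assms that by (auto simp: S_def trading_strategy_def)
  then show ?thesis
    unfolding predictable_def
    by (auto intro: borel_measurable_continuous_on[rotated] intro!: continuous_intros)
qed

lemma V_disc_measurable:
  assumes "\<phi> \<in> S"
  shows "V_disc \<phi> T \<in> borel_measurable (F T)"
proof -
  have "\<phi> T \<in> borel_measurable (F (T - 1))"
    using assms T_ge_1 by (auto simp: S_def trading_strategy_def)
  then have "\<phi> T \<in> borel_measurable (F T)"
    by (rule measurable_F_mono) simp
  then have "(\<lambda>\<omega>. fst (\<phi> T \<omega>)) \<in> borel_measurable (F T)"
    "(\<lambda>\<omega>. snd (\<phi> T \<omega>)) \<in> borel_measurable (F T)"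
    by (auto intro: borel_measurable_continuous_on[rotated] intro!: continuous_intros)
  then show ?thesis
    using T_ge_1 B_measurable[of T] P_ask_adapted[of T] P_bid_adapted[of T]
      dividend_increment_measurable[of T]
    unfolding V_disc_def V_def dividends_def by simp
qed

section \<open>No arbitrage and closedness\<close>

text \<open>(NA) makes the terminal value of \<open>strategy h\<close> zero, and (EF) then makes the
  strategy itself zero. Positivity of \<open>B T\<close> relates the discounted gain to the
  undiscounted value in (NA).\<close>

lemma no_arbitrage_gain:
  assumes "NA" "EF" and h: "predictable h" and nonneg: "AE \<omega> in M. 0 \<le> gain \<omega> (\<lambda>s. h s \<omega>)"
    and s: "s \<in> {1..T}"
  shows "AE \<omega> in M. h s \<omega> = 0"
proof -
  note h_S = strategy_mem_S[OF h]
  have V_T: "AE \<omega> in M. V (strategy h) T \<omega> = gain \<omega> (\<lambda>s. h s \<omega>) * B T \<omega> \<and> 0 < B T \<omega>"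
    using AE_B_pos
  proof eventually_elim
    case (elim \<omega>)
    then have "0 < B T \<omega>"
      by auto
    with fun_cong[OF V_disc_strategy, of h \<omega>] show ?case
      by (simp add: V_disc_def field_simps)
  qed
  have "AE \<omega> in M. 0 \<le> V (strategy h) T \<omega>"
    using V_T nonneg by eventually_elim (simp add: less_imp_le)
  with \<open>NA\<close> h_S have "AE \<omega> in M. V (strategy h) T \<omega> = 0"
    unfolding NA_def by (auto simp: V_strategy_0)
  with h_S have "strategy h \<in> {\<phi> \<in> S. (AE \<omega> in M. V \<phi> 0 \<omega> = 0) \<and> (AE \<omega> in M. V \<phi> T \<omega> = 0)}"
    by (simp add: V_strategy_0)
  then have "strategy h \<in> {\<phi> \<in> S. \<forall>t\<in>{1..T}. AE \<omega> in M. \<phi> t \<omega> = 0}"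
    using \<open>EF\<close> unfolding EF_def by simp
  with s have "AE \<omega> in M. strategy h s \<omega> = 0"
    by blast
  then show ?thesis
    by eventually_elim (use s in \<open>auto simp: strategy_def prod_eq_iff\<close>)
qed

text \<open>Domination by a gain replaces the decomposition: the surplus of the gain over
  \<open>Y\<close> is the nonnegative part subtracted. This form no longer depends on
  representatives and passes to limits.\<close>

lemma mem_K_minus_L0_plus_iff:
  "Y \<in> K_minus_L0_plus \<longleftrightarrow> Y \<in> borel_measurable M \<and>
     (\<exists>h. predictable h \<and> (AE \<omega> in M. Y \<omega> \<le> gain \<omega> (\<lambda>s. h s \<omega>)))"
proof
  assume "Y \<in> K_minus_L0_plus"
  then obtain \<phi> X where \<phi>: "\<phi> \<in> S" "AE \<omega> in M. V \<phi> 0 \<omega> = 0" and X: "X \<in> L0_plus"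
    and Y: "Y = (\<lambda>\<omega>. V_disc \<phi> T \<omega> - X \<omega>)"
    unfolding K_minus_L0_plus_def K_def by blast
  have "Y \<in> borel_measurable (F T)"
    using V_disc_measurable[OF \<phi>(1)] X unfolding Y L0_plus_def by auto
  then have "Y \<in> borel_measurable M"
    using measurable_cong_sets[OF sets_F_T refl] by blast
  moreover have "AE \<omega> in M. 0 \<le> X \<omega>"
    using X by (simp add: L0_plus_def)
  then have "AE \<omega> in M. Y \<omega> \<le> gain \<omega> (\<lambda>s. snd (\<phi> s \<omega>))"
    using V_disc_eq_gain[OF \<phi>] by eventually_elim (simp add: Y)
  ultimately show "Y \<in> borel_measurable M \<and>
      (\<exists>h. predictable h \<and> (AE \<omega> in M. Y \<omega> \<le> gain \<omega> (\<lambda>s. h s \<omega>)))"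
    using predictable_snd[OF \<phi>(1)] by blast
next
  assume "Y \<in> borel_measurable M \<and>
    (\<exists>h. predictable h \<and> (AE \<omega> in M. Y \<omega> \<le> gain \<omega> (\<lambda>s. h s \<omega>)))"
  then obtain h where Y: "Y \<in> borel_measurable M" and h: "predictable h"
    and le: "AE \<omega> in M. Y \<omega> \<le> gain \<omega> (\<lambda>s. h s \<omega>)"
    by blast
  have "V_disc (strategy h) T \<in> K"
    using strategy_mem_S[OF h] unfolding K_def by (auto simp: V_strategy_0)
  moreover have "Y \<in> borel_measurable (F T)"
    using Y measurable_cong_sets[OF sets_F_T refl] by blast
  then have "(\<lambda>\<omega>. V_disc (strategy h) T \<omega> - Y \<omega>) \<in> L0_plus"
    using le V_disc_measurable[OF strategy_mem_S[OF h]]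
    unfolding L0_plus_def by (auto simp: V_disc_strategy)
  ultimately show "Y \<in> K_minus_L0_plus"
    unfolding K_minus_L0_plus_def
    by (intro CollectI exI[of _ "V_disc (strategy h) T"]
        exI[of _ "\<lambda>\<omega>. V_disc (strategy h) T \<omega> - Y \<omega>"]) auto
qed

lemma closed_K_minus_L0_plus:
  assumes "NA" "EF"
  shows "closed_in_prob M K_minus_L0_plus"
  unfolding closed_in_prob_def
proof (intro allI impI, elim conjE)
  fix X Y
  assume X: "\<forall>n. X n \<in> K_minus_L0_plus" and Y: "Y \<in> borel_measurable M"
    and conv: "converges_in_prob M X Y"
  from X have "\<forall>n. \<exists>h. predictable h \<and> (AE \<omega> in M. X n \<omega> \<le> gain \<omega> (\<lambda>s. h s \<omega>))"
    and X_M: "\<And>n. X n \<in> borel_measurable M"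
    by (auto simp: mem_K_minus_L0_plus_iff)
  then obtain h where h: "\<And>n. predictable (h n)"
    and le: "\<And>n. AE \<omega> in M. X n \<omega> \<le> gain \<omega> (\<lambda>s. h n s \<omega>)"
    by metis
  obtain \<rho> :: "nat \<Rightarrow> nat" where \<rho>: "AE \<omega> in M. (\<lambda>k. X (\<rho> k) \<omega>) \<longlonglongrightarrow> Y \<omega>"
    by (rule converges_in_prob_imp_AE_subseq[OF prob_space_axioms X_M Y conv])
  have "\<exists>g. (\<forall>s\<in>{1..T}. g s \<in> borel_measurable (F (s - 1))) \<and> (\<forall>s\<in>{1..<1}. g s = (\<lambda>\<omega>. 0)) \<and>
      (AE \<omega> in M. Y \<omega> \<le> gain \<omega> (\<lambda>s. g s \<omega>))"
  \<comment> \<open>At \<open>t = 1\<close> no date has converged yet, so the past limits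
    \<open>l\<close> are a placeholder and the measurability requirement is plain
    predictability.\<close>
  proof (rule limit_dominated_by_gain[where T = T and h = "\<lambda>k. h (\<rho> k)"
        and Z = "\<lambda>k. X (\<rho> k)" and t = 1 and l = "\<lambda>s \<omega>. 0"])
    show "AE \<omega> in M. g s \<omega> = 0"
      if "\<And>s. s \<in> {1..T} \<Longrightarrow> g s \<in> borel_measurable (F (s - 1))"
        "AE \<omega> in M. 0 \<le> gain \<omega> (\<lambda>s. g s \<omega>)" "s \<in> {1..T}" for g s
      using no_arbitrage_gain[OF assms _ that(2,3)] that(1) by (auto simp: predictable_def)
    show "h (\<rho> m) s \<in> borel_measurable (F (max s 1 - 1))" if "s \<in> {1..T}" for m s
      using h[of "\<rho> m"] that by (simp add: predictable_def max_absorb1)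
  qed (use filtration_axioms tendsto_gain gain_scaleR T_ge_1 \<rho> le in auto)
  with Y show "Y \<in> K_minus_L0_plus"
    unfolding mem_K_minus_L0_plus_iff predictable_def by blast
qed

end

theorem theorem3p2:
  fixes M :: "'a measure" and F :: "nat \<Rightarrow> 'a measure" and T :: nat
    and r :: "nat \<Rightarrow> 'a \<Rightarrow> real"
    and P_ask P_bid A_ask A_bid :: "nat \<Rightarrow> 'a \<Rightarrow> real ^ 'n"
  assumes "bid_ask_market M F T r P_ask P_bid A_ask A_bid"
    and "bid_ask_market.NA M F T r P_ask P_bid A_ask A_bid"
    and "bid_ask_market.EF M F T r P_ask P_bid A_ask A_bid"
  shows "closed_in_prob M (bid_ask_market.K_minus_L0_plus M F T r P_ask P_bid A_ask A_bid)"
  using bid_ask_market.closed_K_minus_L0_plus[OF assms] .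

end
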